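(* Let $d\geq 1$, $i\geq 0$, $I=[i,i+d-1]$ and $J=\{j_1,\ldots,j_d\}$ with $0\leq j_1<\cdots<j_d$, and suppose $J\leq I$. Then for every $1\leq k\leq d-1$, \[ b^I_J=\Big(\prod_{\ell=0}^{k-1}\pi^{I^{(\ell)}}_{J^{(\ell)}}\Big)\, b^{I^{(k)}}_{J^{(k)}}, \] and moreover \[ b^I_J=\prod_{\ell=0}^{d-1}\pi^{I^{(\ell)}}_{J^{(\ell)}}. \]
   Context: For integers $p,q\geq 0$, $b_{p,q}=\binom{p}{q}$, with $b_{p,q}=0$ if $q>p$. For $k\leq l$, $[k,l]=\{k,\ldots,l\}$. For finite sets $I=\{i_1<\cdots<i_m\}$, $J=\{j_1<\cdots<j_m\}$ of non-negative integers, $b^I_J$ is the determinant of the $m\times m$ matrix with $(r,s)$ entry $b_{i_r,j_s}$; $J\leq I$ means $j_k\leq i_k$ for all $k$; and when $J\leq I$, $\pi^I_J=\frac{b_{i_1,j_1}\cdots b_{i_m,j_1}}{b_{j_1,j_1}\cdots b_{j_m,j_1}}$. For a set $S$ of integers and an integer $p$, $S-p=\{s-p: s\in S\}$. With $I=[i,i+d-1]$ and $J=\{j_1<\cdots<j_d\}\leq I$, set $I^{(0)}=I$, $J^{(0)}=J$, and for $1\leq k\leq d-1$: $I^{(k)}=[i+k-1,\,i+d-2]-j_k$ and $J^{(k)}=\{j_{k+1},\ldots,j_d\}-j_k-1$ (both of cardinality $d-k$). *)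

theory Defs
  imports "Jordan_Normal_Form.Determinant"
begin

text \<open>Elements are counted from 1: if \<open>S = {s\<^sub>1 < \<dots> < s\<^sub>m}\<close> is finite and \<open>1 \<le> k \<le> m\<close>,
  then \<open>elem S k\<close> is \<open>s\<^sub>k\<close>.\<close>

definition elem :: "nat set \<Rightarrow> nat \<Rightarrow> nat" where
  "elem S k = sorted_list_of_set S ! (k - 1)"

definition set_le :: "nat set \<Rightarrow> nat set \<Rightarrow> bool" where
  "set_le J I \<longleftrightarrow> finite J \<and> finite I \<and> card J = card I \<and>
     (\<forall>k\<in>{1..card I}. elem J k \<le> elem I k)"

definition b :: "nat \<Rightarrow> nat \<Rightarrow> rat" where
  "b p q = of_nat (p choose q)"

text \<open>Matrix indices of type \<^typ>\<open>'a mat\<close> start at 0, whence the successors.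
  Only used for \<open>card I = card J\<close>.\<close>

definition b_det :: "nat set \<Rightarrow> nat set \<Rightarrow> rat" where
  "b_det I J =
     det (mat (card I) (card I) (\<lambda>(r, s). b (elem I (Suc r)) (elem J (Suc s))))"

text \<open>Only used for nonempty \<open>J\<close> with \<open>set_le J I\<close>.\<close>

definition pi_quot :: "nat set \<Rightarrow> nat set \<Rightarrow> rat" where
  "pi_quot I J = (\<Prod>p\<in>I. b p (elem J 1)) / (\<Prod>q\<in>J. b q (elem J 1))"

definition shift :: "nat set \<Rightarrow> nat \<Rightarrow> nat set" where
  "shift S p = (\<lambda>s. s - p) ` S"

text \<open>The sets \<open>I\<^sup>(\<^sup>k\<^sup>)\<close> and \<open>J\<^sup>(\<^sup>k\<^sup>)\<close> for \<open>k < d\<close>, where \<open>I = {i..i + d - 1}\<close> and \<open>card J = d\<close>.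
  No subtraction on \<^typ>\<open>nat\<close> truncates when \<open>set_le J I\<close>; see \<open>int_I_seq\<close> and \<open>int_J_seq\<close> below.\<close>

definition I_seq :: "nat \<Rightarrow> nat \<Rightarrow> nat set \<Rightarrow> nat \<Rightarrow> nat set" where
  "I_seq i d J k =
     (if k = 0 then {i..i + d - 1} else shift {i + k - 1..i + d - 2} (elem J k))"

definition J_seq :: "nat \<Rightarrow> nat set \<Rightarrow> nat \<Rightarrow> nat set" where
  "J_seq d J k =
     (if k = 0 then J else shift (elem J ` {k + 1..d}) (elem J k + 1))"

lemma elem_less:
  assumes "finite S" "1 \<le> k" "k < l" "l \<le> card S"
  shows "elem S k < elem S l"
  unfolding elem_def
  using assms sorted_wrt_nth_less[OF strict_sorted_list_of_set[of S], of "k - 1" "l - 1"]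
  by simp

lemma elem_interval:
  assumes "1 \<le> k" "k \<le> d"
  shows "elem {i..i + d - 1} k = i + k - 1"
proof -
  have "{i..i + d - 1} = {i..<i + d}" using assms by auto
  then show ?thesis using assms by (simp add: elem_def)
qed

lemma int_I_seq:
  assumes "set_le J {i..i + d - 1}" "1 \<le> k" "k \<le> d - 1"
  shows "int ` I_seq i d J k =
    (\<lambda>s. s - int (elem J k)) ` {int i + int k - 1..int i + int d - 2}"
proof -
  have "elem J k \<le> elem {i..i + d - 1} k"
    using assms by (auto simp: set_le_def)
  then have le: "elem J k \<le> i + k - 1"
    using assms elem_interval[of k d i] by auto
  have "int ` {i + k - 1..i + d - 2} = {int i + int k - 1..int i + int d - 2}"
    using assms by (simp add: image_int_atLeastAtMost of_nat_diff)
  moreover have "int ` shift {i + k - 1..i + d - 2} (elem J k) =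
      (\<lambda>s. s - int (elem J k)) ` int ` {i + k - 1..i + d - 2}"
    unfolding shift_def image_image using le by (intro image_cong) (auto simp: of_nat_diff)
  ultimately show ?thesis using assms by (simp add: I_seq_def)
qed

lemma int_J_seq:
  assumes "finite J" "card J = d" "1 \<le> k"
  shows "int ` J_seq d J k =
    (\<lambda>l. int (elem J l) - int (elem J k) - 1) ` {k + 1..d}"
proof -
  have "elem J k + 1 \<le> elem J l" if "l \<in> {k + 1..d}" for l
    using elem_less[of J k l] that assms by auto
  then show ?thesis
    using assms unfolding J_seq_def shift_def
    by (auto simp: image_image of_nat_diff intro!: image_cong)
qed

end

theory Submission
  imports Defs
begin

text \<open>The identity \<open>(p choose q) (q choose a) = (p choose a) (p - a choose q - a)\<close> with \<open>a = j\<^sub>1\<close>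
  extracts the factor \<open>\<pi>\<close> from the rows and columns of the matrix and replaces \<open>I\<close>, \<open>J\<close> by
  \<open>I - j\<^sub>1\<close>, \<open>J - j\<^sub>1\<close>. Now the first column consists of ones; since the rows are indexed by an
  interval, subtracting from each row its predecessor and applying Pascal's rule leaves the
  determinant of \<open>I\<^sup>(\<^sup>1\<^sup>)\<close>, \<open>J\<^sup>(\<^sup>1\<^sup>)\<close>. The pair \<open>(I\<^sup>(\<^sup>k\<^sup>+\<^sup>1\<^sup>), J\<^sup>(\<^sup>k\<^sup>+\<^sup>1\<^sup>))\<close> arises in the same way from
  \<open>(I\<^sup>(\<^sup>k\<^sup>), J\<^sup>(\<^sup>k\<^sup>))\<close>, and \<open>d\<close> steps reach the empty determinant.\<close>

section \<open>Determinants of binomial coefficients\<close>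

lemma det_scale_rows_cols:
  fixes A :: "nat \<Rightarrow> nat \<Rightarrow> 'a :: comm_ring_1"
  shows "det (mat n n (\<lambda>(r, s). u r * A r s * v s)) =
    (\<Prod>r<n. u r) * det (mat n n (\<lambda>(r, s). A r s)) * (\<Prod>s<n. v s)"
proof -
  have "(\<Prod>r = 0..<n. u r * A r (p r) * v (p r)) =
      (\<Prod>r<n. u r) * (\<Prod>r = 0..<n. A r (p r)) * (\<Prod>s<n. v s)"
    if "p permutes {0..<n}" for p
    using prod.permute[OF that, of v] by (simp add: prod.distrib comp_def atLeast0LessThan)
  then show ?thesis
    by (auto simp: det_def sum_distrib_left sum_distrib_right algebra_simps permutes_in_image
        intro!: sum.cong)
qed

text \<open>Iterated Pascal's rule. It writes row \<open>r\<close> of a binomial matrix as row 0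
  plus the first \<open>r\<close> differences of consecutive rows.\<close>

lemma choose_telescope:
  "(m + r) choose Suc q = (m choose Suc q) + (\<Sum>k<r. (m + k) choose q)"
  by (induction r) simp_all

lemma det_binomial_first_zero:
  fixes c :: "nat \<Rightarrow> nat" and m n :: nat
  assumes "c 0 = 0" and pos: "\<And>s. 1 \<le> s \<Longrightarrow> s \<le> n \<Longrightarrow> 0 < c s"
  shows "det (mat (Suc n) (Suc n) (\<lambda>(r, s). of_nat ((m + r) choose c s))) =
    (det (mat n n (\<lambda>(r, s). of_nat ((m + r) choose (c (Suc s) - 1)))) :: 'a :: idom)"
proof -
  \<comment> \<open>Row 0 is kept; every later row is the difference of two consecutive original
    rows, evaluated by Pascal's rule. Column 0, constantly 1 before because \<open>c 0 = 0\<close>,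
    becomes a unit vector.\<close>
  define M :: "'a mat" where "M = mat (Suc n) (Suc n) (\<lambda>(r, s).
    if r = 0 then of_nat (m choose c s)
    else if s = 0 then 0 else of_nat ((m + r - 1) choose (c s - 1)))"
  \<comment> \<open>Left multiplication by \<open>P\<close> undoes the row subtractions.\<close>
  define P :: "'a mat" where "P = mat (Suc n) (Suc n) (\<lambda>(r, s). if s \<le> r then 1 else 0)"
  have carrier: "M \<in> carrier_mat (Suc n) (Suc n)" "P \<in> carrier_mat (Suc n) (Suc n)"
    by (simp_all add: M_def P_def)
  have "mat (Suc n) (Suc n) (\<lambda>(r, s). of_nat ((m + r) choose c s)) = P * M"
  proof (rule eq_matI)
    fix r s assume "r < dim_row (P * M)" "s < dim_col (P * M)"
    then have rs: "r < Suc n" "s < Suc n" using carrier by auto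
    have "(P * M) $$ (r, s) = (\<Sum>k = 0..<Suc n. (if k \<le> r then 1 else 0) * M $$ (k, s))"
      using rs carrier by (simp add: scalar_prod_def P_def)
    also have "\<dots> = (\<Sum>k\<in>{..<Suc r}. M $$ (k, s))"
      using rs by (intro sum.mono_neutral_cong_right) auto
    also have "\<dots> = M $$ (0, s) + (\<Sum>k<r. M $$ (Suc k, s))"
      by (rule sum.lessThan_Suc_shift)
    also have "\<dots> = of_nat ((m + r) choose c s)"
    proof (cases s)
      case 0
      then show ?thesis using rs assms by (simp add: M_def)
    next
      case (Suc t)
      then have "c s = Suc (c s - 1)" using pos[of s] rs by simp
      then have "(m + r) choose c s = (m choose c s) + (\<Sum>k<r. (m + k) choose (c s - 1))"
        using choose_telescope[of m r "c s - 1"] by simp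
      then show ?thesis using rs Suc by (simp add: M_def)
    qed
    finally show "mat (Suc n) (Suc n) (\<lambda>(r, s). of_nat ((m + r) choose c s)) $$ (r, s) =
        (P * M) $$ (r, s)" using rs by simp
  qed (use carrier in auto)
  moreover have "det P = 1"
    by (subst det_lower_triangular[OF _ carrier(2)]) (simp_all add: P_def prod_list_diag_prod)
  moreover have "det M = det (mat n n (\<lambda>(r, s). of_nat ((m + r) choose (c (Suc s) - 1))))"
  proof -
    \<comment> \<open>Only the corner entry 1 of column 0 contributes.\<close>
    have "det M = (\<Sum>r<Suc n. M $$ (r, 0) * cofactor M r 0)"
      by (rule laplace_expansion_column[OF carrier(1)]) simp
    also have "\<dots> = det (mat_delete M 0 0)"
      unfolding sum.lessThan_Suc_shift
      using assms by (simp add: M_def cofactor_def)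
    also have "mat_delete M 0 0 =
        mat n n (\<lambda>(r, s). of_nat ((m + r) choose (c (Suc s) - 1)))"
      by (rule eq_matI) (simp_all add: mat_delete_def M_def)
    finally show ?thesis .
  qed
  ultimately show ?thesis using det_mult[OF carrier(2,1)] by simp
qed

text \<open>One passage from stage \<open>k\<close> to stage \<open>k + 1\<close>: scaling rows and
  columns makes the lower indices start at 0, and the row differences then remove a row and a
  column. Rows are given by the start \<open>m\<close> of an interval and columns by a function
  \<open>c\<close>, so that no sorted enumeration of sets interferes.\<close>

lemma det_binomial_step:
  fixes c :: "nat \<Rightarrow> nat" and m n :: nat
  assumes "c 0 \<le> m" and less: "\<And>s. 1 \<le> s \<Longrightarrow> s \<le> n \<Longrightarrow> c 0 < c s"
  shows "(det (mat (Suc n) (Suc n) (\<lambda>(r, s). of_nat ((m + r) choose c s))) :: 'a :: field_char_0) =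
    (\<Prod>r<Suc n. of_nat ((m + r) choose c 0)) / (\<Prod>s<Suc n. of_nat (c s choose c 0)) *
    det (mat n n (\<lambda>(r, s). of_nat ((m - c 0 + r) choose (c (Suc s) - c 0 - 1))))"
proof -
  have le: "c 0 \<le> c s" if "s < Suc n" for s
    using less[of s] that by (cases s) auto
  have entry: "(of_nat ((m + r) choose c s) :: 'a) = of_nat ((m + r) choose c 0) *
      of_nat ((m - c 0 + r) choose (c s - c 0)) * (1 / of_nat (c s choose c 0))"
    if "s < Suc n" for r s
  proof -
    have "((m + r) choose c s) * (c s choose c 0) =
        ((m + r) choose c 0) * ((m - c 0 + r) choose (c s - c 0))"
    proof (cases "c s \<le> m + r")
      case True
      then show ?thesis using choose_mult[OF le[OF that] True] assms(1) by simp
    next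
      \<comment> \<open>Outside the range of \<open>choose_mult\<close> both sides vanish:
        \<open>m + r < c s\<close> and \<open>c 0 \<le> m\<close> give
        \<open>m - c 0 + r < c s - c 0\<close>.\<close>
      case False
      then show ?thesis using assms(1) by (simp add: binomial_eq_0)
    qed
    then have "(of_nat ((m + r) choose c s) * of_nat (c s choose c 0) :: 'a) =
        of_nat ((m + r) choose c 0) * of_nat ((m - c 0 + r) choose (c s - c 0))"
      by (metis of_nat_mult)
    moreover have "(of_nat (c s choose c 0) :: 'a) \<noteq> 0"
      using le[OF that] by simp
    ultimately show ?thesis by (simp add: field_simps)
  qed
  have "(det (mat (Suc n) (Suc n) (\<lambda>(r, s). of_nat ((m + r) choose c s))) :: 'a) =
      det (mat (Suc n) (Suc n) (\<lambda>(r, s). of_nat ((m + r) choose c 0) *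
        of_nat ((m - c 0 + r) choose (c s - c 0)) * (1 / of_nat (c s choose c 0))))"
    by (intro arg_cong[where f = det] cong_mat refl) (simp only: prod.case, rule entry)
  also have "\<dots> = (\<Prod>r<Suc n. of_nat ((m + r) choose c 0)) *
      det (mat (Suc n) (Suc n) (\<lambda>(r, s). of_nat ((m - c 0 + r) choose (c s - c 0)))) *
      (\<Prod>s<Suc n. 1 / of_nat (c s choose c 0))"
    by (rule det_scale_rows_cols)
  also have "det (mat (Suc n) (Suc n) (\<lambda>(r, s). of_nat ((m - c 0 + r) choose (c s - c 0)))) =
      (det (mat n n (\<lambda>(r, s). of_nat ((m - c 0 + r) choose (c (Suc s) - c 0 - 1)))) :: 'a)"
    by (rule det_binomial_first_zero[where c = "\<lambda>s. c s - c 0"]) (use less in auto)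
  finally show ?thesis by (simp add: prod_dividef)
qed

section \<open>Enumerating finite sets by strictly increasing functions\<close>

lemma image_add_lessThan:
  fixes a n :: nat
  assumes "0 < n"
  shows "(\<lambda>r. a + r) ` {..<n} = {a..a + n - 1}"
proof -
  have "{a..a + n - 1} = {a..<a + n}" using assms by auto
  then show ?thesis
    using image_add_atLeastLessThan[of a 0 n] by (simp add: atLeast0LessThan add.commute)
qed

lemma elem_image:
  fixes f :: "nat \<Rightarrow> nat"
  assumes "strict_mono_on {..<n} f" "s < n"
  shows "elem (f ` {..<n}) (Suc s) = f s"
proof -
  have "sorted_list_of_set (f ` {..<n}) = map f [0..<n]"
  proof (rule sorted_distinct_set_unique)
    have "sorted_wrt (<) (map f [0..<n])"
      using assms(1) by (auto simp: sorted_wrt_iff_nth_less strict_mono_on_def)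
    then show "sorted (map f [0..<n])" "distinct (map f [0..<n])"
      by (simp_all add: strict_sorted_iff)
  qed (simp_all add: atLeast0LessThan)
  then show ?thesis using assms(2) by (simp add: elem_def)
qed

lemma elem_image_eq:
  assumes "finite S"
  shows "(\<lambda>s. elem S (Suc s)) ` {..<card S} = S"
proof -
  have "(\<lambda>s. elem S (Suc s)) ` {..<card S} = set (sorted_list_of_set S)"
    by (auto simp: elem_def set_conv_nth simp del: set_sorted_list_of_set)
  then show ?thesis using assms by simp
qed

lemma b_det_image:
  assumes "strict_mono_on {..<n} f" "strict_mono_on {..<n} g"
  shows "b_det (f ` {..<n}) (g ` {..<n}) = det (mat n n (\<lambda>(r, s). b (f r) (g s)))"
proof -
  have "card (f ` {..<n}) = n"
    using assms(1) by (simp add: card_image strict_mono_on_imp_inj_on)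
  then show ?thesis unfolding b_det_def
    by (intro arg_cong[where f = det] eq_matI) (use assms in \<open>auto simp: elem_image\<close>)
qed

lemma pi_quot_image:
  fixes f g :: "nat \<Rightarrow> nat"
  assumes "strict_mono_on {..<n} f" "strict_mono_on {..<n} g" "0 < n"
  shows "pi_quot (f ` {..<n}) (g ` {..<n}) = (\<Prod>r<n. b (f r) (g 0)) / (\<Prod>s<n. b (g s) (g 0))"
proof -
  have "elem (g ` {..<n}) 1 = g 0"
    using elem_image[OF assms(2), of 0] assms(3) by simp
  then show ?thesis
    using assms by (simp add: pi_quot_def prod.reindex strict_mono_on_imp_inj_on)
qed

theorem theorem4p4:
  fixes d i :: nat and I J :: "nat set"
  assumes "d \<ge> 1"
    and "I = {i..i + d - 1}"
    and "finite J" and "card J = d"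
    and "set_le J I"
  shows "(\<forall>k\<in>{1..d - 1}.
            b_det I J =
              (\<Prod>l = 0..k - 1. pi_quot (I_seq i d J l) (J_seq d J l)) *
              b_det (I_seq i d J k) (J_seq d J k)) \<and>
         b_det I J = (\<Prod>l = 0..d - 1. pi_quot (I_seq i d J l) (J_seq d J l))"
proof -
  \<comment> \<open>For \<open>k < d\<close>, \<open>m k\<close> is the least element of
    \<open>I_seq i d J k\<close>, and \<open>c k s\<close> is the element number
    \<open>s + 1\<close> of \<open>J_seq d J k\<close>. Stage 0 is separate because nothing has been
    subtracted yet.\<close>
  define m where "m k = (if k = 0 then i else i + k - 1 - elem J k)" for k
  define c where
    "c k s = (if k = 0 then elem J (Suc s) else elem J (k + 1 + s) - (elem J k + 1))" for k s
  have mono: "elem J k < elem J l" if "1 \<le> k" "k < l" "l \<le> d" for k l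
    using elem_less assms that by simp
  have le: "elem J k \<le> i + k - 1" if "1 \<le> k" "k \<le> d" for k
  proof -
    have "elem J k \<le> elem I k"
      using assms(4,5) that by (simp add: set_le_def)
    then show ?thesis
      unfolding assms(2) elem_interval[OF that] .
  qed
  have I_eq: "I_seq i d J k = (\<lambda>r. m k + r) ` {..<d - k}" if "k < d" for k
  proof -
    have "I_seq i d J k = (\<lambda>x. x - (if k = 0 then 0 else elem J k)) `
        (\<lambda>r. (if k = 0 then i else i + k - 1) + r) ` {..<d - k}"
      using image_add_lessThan[of "d - k" "if k = 0 then i else i + k - 1"] that
      by (simp add: I_seq_def shift_def numeral_2_eq_2)
    also have "\<dots> = (\<lambda>r. m k + r) ` {..<d - k}"
      unfolding image_image by (rule image_cong) (use le[of k] that in \<open>auto simp: m_def\<close>)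
    finally show ?thesis .
  qed
  have J_eq: "J_seq d J k = c k ` {..<d - k}" if "k < d" for k
  proof (cases "k = 0")
    case True
    then show ?thesis
      using elem_image_eq[OF assms(3)] assms(4) by (simp add: J_seq_def c_def)
  next
    case False
    have "{k + 1..d} = (\<lambda>s. k + 1 + s) ` {..<d - k}"
      using image_add_lessThan[of "d - k" "k + 1"] that by simp
    then show ?thesis
      using False by (simp add: J_seq_def shift_def c_def image_image)
  qed
  have mono_I: "strict_mono_on {..<d - k} (\<lambda>r. m k + r)" for k
    by (simp add: strict_mono_on_def)
  have mono_J: "strict_mono_on {..<d - k} (c k)" for k
  proof (rule strict_mono_onI)
    fix s t assume st: "s \<in> {..<d - k}" "t \<in> {..<d - k}" "s < t"
    then have "elem J (k + 1 + s) < elem J (k + 1 + t)"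
      by (intro mono) auto
    moreover have "elem J k < elem J (k + 1 + s)" if "k \<noteq> 0"
      using st that by (intro mono) auto
    ultimately show "c k s < c k t"
      by (cases "k = 0") (simp_all add: c_def diff_less_mono)
  qed
  \<comment> \<open>The right side is an explicit matrix because \<open>I_seq\<close> and
    \<open>J_seq\<close> are meant only for indices below \<open>d\<close>; for
    \<open>Suc k = d\<close> the matrix is empty.\<close>
  have step: "b_det (I_seq i d J k) (J_seq d J k) = pi_quot (I_seq i d J k) (J_seq d J k) *
      det (mat (d - Suc k) (d - Suc k) (\<lambda>(r, s). b (m (Suc k) + r) (c (Suc k) s)))"
    if k: "k < d" for k
  proof -
    have n: "d - k = Suc (d - Suc k)" using k by simp
    \<comment> \<open>Here and in \<open>c_Suc\<close> the shifts by \<open>elem J k\<close> cancel,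
      so that each stage is measured from \<open>elem J (Suc k)\<close> alone.\<close>
    have m_Suc: "m (Suc k) = m k - c k 0"
      using mono[of k "Suc k"] le[of k] k by (auto simp: m_def c_def)
    have c_Suc: "c (Suc k) s = c k (Suc s) - c k 0 - 1" if "s < d - Suc k" for s
    proof (cases "k = 0")
      case False
      then have "elem J k < elem J (Suc k)"
        using k by (intro mono) auto
      then show ?thesis using False by (simp add: c_def)
    qed (simp add: c_def)
    \<comment> \<open>After cancellation this reads \<open>elem J (Suc k) \<le> i + k\<close>, which
      is the hypothesis \<open>set_le J I\<close> at index \<open>Suc k\<close>.\<close>
    have "c k 0 \<le> m k"
      using le[of "Suc k"] mono[of k "Suc k"] k by (auto simp: m_def c_def)
    moreover have "c k 0 < c k s" if "1 \<le> s" "s \<le> d - Suc k" for s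
      using strict_mono_onD[OF mono_J, of 0 k s] that k by auto
    ultimately have "det (mat (d - k) (d - k) (\<lambda>(r, s). b (m k + r) (c k s))) =
        (\<Prod>r<d - k. b (m k + r) (c k 0)) / (\<Prod>s<d - k. b (c k s) (c k 0)) *
        det (mat (d - Suc k) (d - Suc k)
          (\<lambda>(r, s). b (m k - c k 0 + r) (c k (Suc s) - c k 0 - 1)))"
      unfolding b_def n by (rule det_binomial_step[where c = "c k"])
    also have "mat (d - Suc k) (d - Suc k)
          (\<lambda>(r, s). b (m k - c k 0 + r) (c k (Suc s) - c k 0 - 1)) =
        mat (d - Suc k) (d - Suc k) (\<lambda>(r, s). b (m (Suc k) + r) (c (Suc k) s))"
      by (rule eq_matI) (simp_all add: m_Suc c_Suc)
    finally show ?thesis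
      using k by (simp add: I_eq J_eq b_det_image pi_quot_image mono_I mono_J)
  qed
  have prod: "b_det I J = (\<Prod>l<k. pi_quot (I_seq i d J l) (J_seq d J l)) *
      det (mat (d - k) (d - k) (\<lambda>(r, s). b (m k + r) (c k s)))" if "k \<le> d" for k
    using that
  proof (induction k)
    case 0
    have "I = I_seq i d J 0" "J = J_seq d J 0"
      using assms(2) by (simp_all add: I_seq_def J_seq_def)
    then have "b_det I J = b_det ((\<lambda>r. m 0 + r) ` {..<d - 0}) (c 0 ` {..<d - 0})"
      using I_eq[of 0] J_eq[of 0] assms(1) by simp
    then show ?case
      by (simp only: b_det_image[OF mono_I mono_J]) simp
  next
    case (Suc k)
    then show ?case
      using step[of k] by (simp add: I_eq J_eq b_det_image mono_I mono_J)
  qed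
  show ?thesis
  proof (intro conjI ballI)
    fix k assume "k \<in> {1..d - 1}"
    then have k: "k < d" and range: "{0..k - 1} = {..<k}" by auto
    have "b_det (I_seq i d J k) (J_seq d J k) =
        det (mat (d - k) (d - k) (\<lambda>(r, s). b (m k + r) (c k s)))"
      by (simp add: I_eq J_eq k b_det_image mono_I mono_J)
    then show "b_det I J = (\<Prod>l = 0..k - 1. pi_quot (I_seq i d J l) (J_seq d J l)) *
        b_det (I_seq i d J k) (J_seq d J k)"
      using prod[of k] k unfolding range by simp
  next
    \<comment> \<open>At \<open>k = d\<close> the remaining determinant in \<open>prod\<close> is
      that of the empty matrix, hence 1.\<close>
    have "{0..d - 1} = {..<d}" using assms(1) by auto
    then show "b_det I J = (\<Prod>l = 0..d - 1. pi_quot (I_seq i d J l) (J_seq d J l))"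
      using prod[of d] by simp
  qed
qed

end
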